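(* Let $T:[0,\infty)\to[0,\infty)$ be the function that is linear (affine) on each interval $[n,n+1]$, $n\in\mathbb{Z}_{\ge0}$, and whose values at the integers are $T(n)=0$ if $n$ is even, and $T(n)=4^{\ell}+1$ if $n$ is odd and $4^{\ell-1}\le n<4^{\ell}$ with $\ell\in\mathbb{Z}^+$. Then for Lebesgue almost every $x\in[0,\infty)$ the orbit $\{T^k(x):k\ge0\}$ is dense in $[0,\infty)$; thus for almost every $x\in[0,\infty)$ we have $\liminf_{k\to\infty}T^k(x)=0$ and $\limsup_{k\to\infty}T^k(x)=\infty$.
   Context: $T^0(x)=x$ and $T^{n}(x)=T(T^{n-1}(x))$ for $n>0$. *)

theory Defs
  imports "HOL-Analysis.Analysis"
begin

end

theory Submission
  imports Defs
begin

text \<open>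
  \<open>T\<close> maps every unit interval \<open>[n, n + 1]\<close> affinely onto an interval \<open>[0, N]\<close> with integer \<open>N \<ge> 5\<close>.
  Let \<open>B\<close> be the forward invariant set of points whose orbit avoids an open interval \<open>J\<close>.
  The densities \<open>|B \<inter> [n, n + 1]|\<close> form a bounded subharmonic function for the Markov chain that jumps
  from \<open>n\<close> to a uniformly chosen integer of \<open>[0, N)\<close>. This chain is recurrent, so the densities are equal
  to a constant \<open>c\<close>, and then \<open>B = T\<inverse>(B)\<close> up to a null set. Hence \<open>h(x) = |B \<inter> [0, x]| - c x\<close> vanishes at
  the integers and satisfies \<open>|h(x)| = |h(T x)| / N\<close>; being bounded, it is zero. So \<open>B\<close> has density exactly \<open>c\<close> in
  every interval, in particular in \<open>J\<close>, which forces \<open>c = 0\<close>.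
\<close>

section \<open>Levels of the integers between powers of 4\<close>

text \<open>For odd \<open>n\<close> this is the exponent \<open>l\<close> that fixes the value of
  \<open>T\<close> at \<open>n\<close>. The bound \<open>1 \<le> l\<close> puts 0 on the same level
  as 1, so that \<open>lev n\<close> is always the level of the odd endpoint of the interval from
  \<open>n\<close> to \<open>n + 1\<close>.\<close>

definition lev :: "nat \<Rightarrow> nat" where
  "lev n = (LEAST l. 1 \<le> l \<and> n < 4 ^ l)"

lemma less_four_pow: "n < 4 ^ n" for n :: nat
  using less_exp[of n] power_mono[of "2::nat" 4 n] by linarith

lemma lev_ge_1: "1 \<le> lev n" and less_pow_lev: "n < 4 ^ lev n"
proof -
  have "n < 4 ^ Suc n" using less_four_pow[of n] by simp
  then have "\<exists>l. 1 \<le> l \<and> n < 4 ^ l" by (intro exI[of _ "Suc n"]) auto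
  then show "1 \<le> lev n" "n < 4 ^ lev n"
    unfolding lev_def by (metis (mono_tags, lifting) LeastI_ex)+
qed

lemma lev_le: "1 \<le> l \<Longrightarrow> n < 4 ^ l \<Longrightarrow> lev n \<le> l"
  unfolding lev_def by (simp add: Least_le)

lemma lev_eqI: "4 ^ l \<le> n \<Longrightarrow> n < 4 ^ Suc l \<Longrightarrow> lev n = Suc l"
proof -
  assume a: "4 ^ l \<le> n" "n < 4 ^ Suc l"
  have "(4::nat) ^ l < 4 ^ lev n" using a less_pow_lev[of n] by linarith
  then have "l < lev n" by simp
  with lev_le[of "Suc l" n] a show ?thesis by simp
qed

lemma pow_lev_le: "odd n \<Longrightarrow> 4 ^ (lev n - 1) \<le> n"
proof (rule ccontr)
  assume o: "odd n" and "\<not> 4 ^ (lev n - 1) \<le> n"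
  then have *: "n < 4 ^ (lev n - 1)" by simp
  show False
  proof (cases "lev n = 1")
    case True then show ?thesis using * o by simp
  next
    case False
    then have "1 \<le> lev n - 1" using lev_ge_1[of n] by linarith
    then show ?thesis using lev_le[OF _ *] by linarith
  qed
qed

text \<open>A power \<open>4 ^ l\<close> with \<open>1 \<le> l\<close> is even and hence differs
  from the odd number \<open>Suc n\<close>, so no level boundary separates \<open>n\<close> from
  \<open>Suc n\<close>.\<close>

lemma lev_Suc_even: "even n \<Longrightarrow> lev (Suc n) = lev n"
proof -
  assume e: "even n"
  have "n < 4 ^ l \<longleftrightarrow> Suc n < 4 ^ l" if "1 \<le> l" for l :: nat
  proof -
    have "even ((4::nat) ^ l)" using that by simp
    then have "Suc n \<noteq> 4 ^ l" using e by (metis even_Suc)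
    then show ?thesis by linarith
  qed
  then show ?thesis unfolding lev_def by metis
qed

section \<open>Bounded subharmonic functions of the integer chain\<close>

text \<open>
  The maxima \<open>\<beta> l\<close> of \<open>b\<close> over \<open>{0..<4 ^ l}\<close> have nondecreasing increments: from level \<open>l + 1\<close> the chain falls below
  \<open>4 ^ l\<close> with at least the probability with which it climbs to the next level. As \<open>b\<close> is bounded,
  the increments vanish, so \<open>b\<close> attains its maximum, and the maximum principle spreads it to all integers.
\<close>

lemma bounded_subharmonic_const:
  fixes b :: "nat \<Rightarrow> real"
  assumes bdd: "\<And>n. b n \<le> C"
    and sub: "\<And>n. (4 ^ lev n + 1) * b n \<le> (\<Sum>m<4 ^ lev n + 1. b m)"
  shows "b n = b 0"
proof -
  define \<beta> where "\<beta> l = Max (b ` {..<4 ^ l})" for l :: nat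
  have ub: "b n \<le> \<beta> l" if "n < 4 ^ l" for n l
    unfolding \<beta>_def using that by (intro Max_ge) auto
  have att: "\<exists>n<4 ^ l. \<beta> l = b n" for l
  proof -
    have "\<beta> l \<in> b ` {..<4 ^ l}"
      unfolding \<beta>_def by (intro Max_in) (auto simp: lessThan_empty_iff)
    then show ?thesis by auto
  qed
  have mono: "\<beta> l \<le> \<beta> (Suc l)" for l
    using att[of l] ub[of _ "Suc l"] by fastforce
  have step: "\<beta> (Suc l) - \<beta> l \<le> \<beta> (Suc (Suc l)) - \<beta> (Suc l)" for l
  proof -
    obtain n where n: "n < 4 ^ Suc l" "\<beta> (Suc l) = b n" using att by blast
    show ?thesis
    proof (cases "n < 4 ^ l")
      case True
      then show ?thesis using ub[of n l] n mono[of "Suc l"] by linarith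
    next
      case False
      then have lev: "lev n = Suc l" using n by (intro lev_eqI) auto
      \<comment> \<open>The average runs over \<open>4 ^ l\<close> integers below the shell of
        \<open>n\<close>, the \<open>3 * 4 ^ l\<close> integers of the shell and the single integer
        \<open>4 ^ Suc l\<close> beyond it; each group is bounded by its own maximum.\<close>
      have "(\<Sum>m<4 ^ Suc l + 1. b m) = (\<Sum>m<4 ^ l. b m) + (\<Sum>m=4 ^ l..<4 ^ Suc l. b m) + b (4 ^ Suc l)"
        using sum.atLeastLessThan_concat[of 0 "4 ^ l" "4 ^ Suc l" b]
        by (simp add: lessThan_atLeast0)
      also have "(\<Sum>m<4 ^ l. b m) \<le> real (card {..<(4::nat) ^ l}) * \<beta> l"
        by (intro sum_bounded_above ub) auto
      also have "(\<Sum>m=4 ^ l..<4 ^ Suc l. b m) \<le> real (card {(4::nat) ^ l..<4 ^ Suc l}) * \<beta> (Suc l)"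
        by (intro sum_bounded_above ub) auto
      also have "b (4 ^ Suc l) \<le> \<beta> (Suc (Suc l))" by (intro ub) auto
      finally have "(4 ^ Suc l + 1) * \<beta> (Suc l)
          \<le> 4 ^ l * \<beta> l + 3 * 4 ^ l * \<beta> (Suc l) + \<beta> (Suc (Suc l))"
        using sub[of n] n lev by simp
      then have "4 ^ l * (\<beta> (Suc l) - \<beta> l) \<le> \<beta> (Suc (Suc l)) - \<beta> (Suc l)"
        by (simp add: algebra_simps)
      moreover have "1 * (\<beta> (Suc l) - \<beta> l) \<le> 4 ^ l * (\<beta> (Suc l) - \<beta> l)"
        using mono[of l] by (intro mult_right_mono) auto
      ultimately show ?thesis by simp
    qed
  qed
  have const: "\<beta> (Suc l) = \<beta> l" for l
  proof (rule ccontr)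
    \<comment> \<open>A positive increment never shrinks, so \<open>\<beta>\<close> would grow at
      least linearly and pass the bound \<open>C\<close>.\<close>
    assume "\<beta> (Suc l) \<noteq> \<beta> l"
    then have d: "\<beta> (Suc l) - \<beta> l > 0" (is "?d > 0") using mono[of l] by simp
    have inc: "?d \<le> \<beta> (Suc (l + k)) - \<beta> (l + k)" for k
    proof (induction k)
      case (Suc k)
      then show ?case using step[of "l + k"] by simp
    qed simp
    have "\<beta> l + real k * ?d \<le> \<beta> (l + k)" for k
    proof (induction k)
      case (Suc k)
      then show ?case using inc[of k] by (simp add: algebra_simps)
    qed simp
    moreover have "\<beta> k \<le> C" for k using att[of k] bdd by metis
    ultimately have "real k * ?d \<le> C - \<beta> l" for k by (smt (verit))
    then show False using reals_Archimedean3[OF d] by (meson not_le)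
  qed
  have top: "b n \<le> \<beta> 1" for n
  proof -
    have "\<beta> l = \<beta> 0" for l by (induction l) (simp_all add: const)
    then show ?thesis using ub[OF less_pow_lev] by metis
  qed
  \<comment> \<open>Equality case of the maximum principle: the nonnegative deficits
    \<open>\<beta> 1 - b i\<close> have a sum that is at most 0.\<close>
  have spread: "b m = \<beta> 1" if n: "b n = \<beta> 1" and m: "m < 4 ^ lev n + 1" for n m
  proof -
    have "(\<Sum>i<4 ^ lev n + 1. \<beta> 1 - b i) \<le> 0"
      using sub[of n] n by (simp add: sum_subtractf algebra_simps)
    moreover have "(\<Sum>i<4 ^ lev n + 1. \<beta> 1 - b i) \<ge> 0"
      using top by (intro sum_nonneg) (simp add: algebra_simps)
    ultimately have "(\<Sum>i<4 ^ lev n + 1. \<beta> 1 - b i) = 0" by linarith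
    then have "\<forall>i\<in>{..<4 ^ lev n + 1}. \<beta> 1 - b i = 0"
      using top by (subst (asm) sum_nonneg_eq_0_iff) (auto simp: algebra_simps)
    then show ?thesis using m by auto
  qed
  have all: "\<forall>m<4 ^ Suc l + 1. b m = \<beta> 1" for l
  proof (induction l)
    case 0
    obtain n where n: "n < 4 ^ 1" "\<beta> 1 = b n" using att[of 1] by (elim exE conjE)
    have "lev n = Suc 0" using n lev_ge_1[of n] lev_le[of 1 n] by (intro antisym) auto
    then show ?case using spread[OF n(2)[symmetric]] by metis
  next
    case (Suc l)
    \<comment> \<open>The range already covered includes \<open>4 ^ Suc l\<close>, whose level is
      one higher, so spreading from it covers the next shell.\<close>
    have "lev (4 ^ Suc l) = Suc (Suc l)" by (intro lev_eqI) auto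
    then show ?case using spread[of "4 ^ Suc l"] Suc by auto
  qed
  have "n < 4 ^ Suc n + 1" using less_four_pow[of n] by simp
  then show ?thesis using all[of n] by auto
qed

section \<open>The explicit piecewise affine map\<close>

definition slope :: "nat \<Rightarrow> nat" where
  "slope n = 4 ^ lev n + 1"

text \<open>A Borel measurable model of \<open>T\<close> on the whole line, since \<open>T\<close>
  is prescribed only on the half-line. \<open>slope n\<close> is both the absolute slope of the
  branch and its value at the odd endpoint.\<close>

definition tent :: "real \<Rightarrow> real" where
  "tent x = (let n = nat \<lfloor>x\<rfloor> in real (slope n) * (if even n then x - real n else real n + 1 - x))"

lemma slope_ge_5: "5 \<le> slope n"
proof -
  have "(4::nat) ^ 1 \<le> 4 ^ lev n" using lev_ge_1 by (intro power_increasing) auto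
  then show ?thesis by (simp add: slope_def)
qed

lemma slope_pos [simp]: "0 < slope n"
  using slope_ge_5[of n] by linarith

lemma mem_unit_Icc: "0 \<le> x \<Longrightarrow> x \<in> {real (nat \<lfloor>x\<rfloor>)..real (nat \<lfloor>x\<rfloor>) + 1}"
  by simp

text \<open>At the right endpoint the floor already selects the next branch. The two branches agree
  there: both vanish if \<open>n\<close> is odd, and \<open>lev_Suc_even\<close> equates their
  heights if \<open>n\<close> is even.\<close>

lemma tent_eq:
  assumes "x \<in> {real n..real n + 1}"
  shows "tent x = real (slope n) * (if even n then x - real n else real n + 1 - x)"
proof (cases "x = real n + 1")
  case True
  then have "nat \<lfloor>x\<rfloor> = Suc n" by simp
  then show ?thesis using True lev_Suc_even[of n] by (simp add: tent_def slope_def)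
next
  case False
  then have "nat \<lfloor>x\<rfloor> = n" using assms by (intro floor_eq4) auto
  then show ?thesis by (simp add: tent_def)
qed

lemma tent_nonneg: "0 \<le> x \<Longrightarrow> 0 \<le> tent x"
  using tent_eq[OF mem_unit_Icc] mem_unit_Icc[of x] by simp

lemma tent_measurable [measurable]: "tent \<in> borel_measurable borel"
proof -
  have "(\<lambda>x. real (slope n) * (if even n then x - real n else real n + 1 - x)) \<in> borel_measurable borel" for n
    by (cases "even n") simp_all
  moreover have "(\<lambda>x::real. nat \<lfloor>x\<rfloor>) \<in> measurable borel (count_space UNIV)" by measurable
  ultimately show ?thesis
    unfolding tent_def Let_def by (rule measurable_compose_countable)
qed

section \<open>Measures of preimages and of intersections with intervals\<close>

text \<open>Within one unit interval \<open>tent\<close> is affine and injective, so the preimage is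
  the part of \<open>A\<close> in the image interval, scaled by \<open>1 / slope n\<close> and, for
  odd \<open>n\<close>, reflected.\<close>

lemma measure_tent_vimage:
  assumes "real n \<le> u" "u \<le> v" "v \<le> real n + 1"
  shows "measure lebesgue (tent -` A \<inter> {u..v}) =
    measure lebesgue (A \<inter> (if even n then {tent u..tent v} else {tent v..tent u})) / slope n"
proof -
  define N where "N = real (slope n)"
  have N: "N > 0" by (simp add: N_def)
  define r d where "r = (if even n then 1 / N else - 1 / N)"
    and "d = (if even n then real n else real n + 1)"
  have tent: "tent x = N * (if even n then x - real n else real n + 1 - x)" if "u \<le> x" "x \<le> v" for x :: real
    using tent_eq[of x n] that assms by (simp add: N_def)
  have "tent -` A \<inter> {u..v} = (\<lambda>y. r *\<^sub>R y + d) `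
      (A \<inter> (if even n then {tent u..tent v} else {tent v..tent u}))" (is "?L = _ ` ?R")
  proof (intro equalityI subsetI)
    fix x assume x: "x \<in> ?L"
    then have "r * tent x + d = x" using N tent[of x] by (auto simp: r_def d_def field_simps)
    moreover have "tent x \<in> ?R"
      using x N assms tent[of x] tent[of u] tent[of v] by (auto simp: mult_left_mono)
    ultimately show "x \<in> (\<lambda>y. r *\<^sub>R y + d) ` ?R" by (metis image_eqI real_scaleR_def)
  next
    fix x assume "x \<in> (\<lambda>y. r *\<^sub>R y + d) ` ?R"
    then obtain y where y: "y \<in> ?R" "x = r * y + d" by auto
    have x: "u \<le> x" "x \<le> v"
      using y N assms tent[of u] tent[of v] by (auto simp: r_def d_def field_simps split: if_splits)
    have "tent x = y" using tent[OF x] y(2) N by (auto simp: r_def d_def field_simps)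
    then show "x \<in> ?L" using x y(1) by auto
  qed
  moreover have "\<bar>r\<bar> = 1 / N" using N by (simp add: r_def)
  ultimately show ?thesis
    by (simp only: measure_lebesgue_affine) (simp add: N_def)
qed

lemma lmeasurable_Int_Icc:
  fixes u v :: real
  assumes "A \<in> sets borel"
  shows "A \<inter> {u..v} \<in> lmeasurable"
proof (rule fmeasurableI2[of "{u..v}"])
  show "A \<inter> {u..v} \<in> sets lebesgue" using assms by (intro sets_completionI_sets) simp
qed auto

lemma measure_Int_Icc_split:
  fixes u :: real
  assumes A: "A \<in> sets borel" and "u \<le> v" "v \<le> w"
  shows "measure lebesgue (A \<inter> {u..w}) =
    measure lebesgue (A \<inter> {u..v}) + measure lebesgue (A \<inter> {v..w})"
proof -
  note fm = lmeasurable_Int_Icc[OF A]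
  have "A \<inter> {u..v} \<inter> (A \<inter> {v..w}) \<subseteq> {v}" by auto
  then have "negligible (A \<inter> {u..v} \<inter> (A \<inter> {v..w}))"
    using negligible_subset negligible_sing by blast
  then have "measure lebesgue (A \<inter> {u..v} \<inter> (A \<inter> {v..w})) = 0"
    using negligible_imp_measure0 by blast
  moreover have "A \<inter> {u..w} = A \<inter> {u..v} \<union> A \<inter> {v..w}" using assms by auto
  ultimately show ?thesis using measure_Un3[OF fm[of u v] fm[of v w]] by simp
qed

section \<open>Forward invariant sets\<close>

lemma tent_invariant_density:
  assumes B: "B \<in> sets borel" and inv: "\<And>x. x \<in> B \<Longrightarrow> tent x \<in> B"
  obtains c where "\<And>x. 0 \<le> x \<Longrightarrow> measure lebesgue (B \<inter> {0..x}) = c * x"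
proof -
  define b where "b n = measure lebesgue (B \<inter> {real n..real n + 1})" for n
  define g where "g x = measure lebesgue (B \<inter> {0..x})" for x
  have B': "tent -` B \<in> sets borel" using measurable_sets[OF tent_measurable B] by simp
  note fm = lmeasurable_Int_Icc
  have vimage_ge: "measure lebesgue (B \<inter> {u..v}) \<le> measure lebesgue (tent -` B \<inter> {u..v})" for u v
    using inv by (intro measure_mono_fmeasurable fm B' fmeasurableD[OF fm[OF B]]) auto
  have g_add: "g v = g u + measure lebesgue (B \<inter> {u..v})" if "0 \<le> u" "u \<le> v" for u v
    unfolding g_def using measure_Int_Icc_split[OF B] that by blast
  have "g 0 = 0"
    unfolding g_def using negligible_subset[OF negligible_sing[of "0::real"], of "B \<inter> {0..0}"]
    by (intro negligible_imp_measure0) auto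
  then have g_sum: "g (real k) = (\<Sum>i<k. b i)" for k
  proof (induction k)
    case (Suc k)
    then show ?case using g_add[of "real k" "real k + 1"] by (simp add: b_def add.commute)
  qed simp
  \<comment> \<open>The branch covers the interval from 0 to \<open>slope n\<close>, so this is the
    mean of \<open>b\<close> over the integers below \<open>slope n\<close>.\<close>
  have vimage_unit: "measure lebesgue (tent -` B \<inter> {real n..real n + 1}) = g (slope n) / slope n" for n
    using measure_tent_vimage[of n "real n" "real n + 1" B] tent_eq[of "real n" n] tent_eq[of "real n + 1" n]
    by (simp add: g_def)
  have bound: "measure lebesgue (B \<inter> {u..v}) \<le> v - u" if "u \<le> v" for u v
    using measure_mono_fmeasurable[of "B \<inter> {u..v}" "{u..v}" lebesgue] fmeasurableD[OF fm[OF B]] that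
    by simp
  have "(4 ^ lev n + 1) * b n \<le> (\<Sum>m<4 ^ lev n + 1. b m)" for n
  proof -
    have "b n \<le> (\<Sum>m<slope n. b m) / real (slope n)"
      unfolding b_def[of n] g_sum[symmetric] vimage_unit[symmetric] by (rule vimage_ge)
    then have "real (slope n) * b n \<le> (\<Sum>m<slope n. b m)"
      by (simp add: pos_le_divide_eq mult.commute)
    then show ?thesis unfolding slope_def by (simp add: add.commute)
  qed
  moreover have "b n \<le> 1" for n using bound[of "real n" "real n + 1"] by (simp add: b_def)
  ultimately have b_const: "b n = b 0" for n by (rule bounded_subharmonic_const[rotated])
  define c where "c = b 0"
  have c: "0 \<le> c" "c \<le> 1" using bound[of 0 1] by (auto simp: c_def b_def)
  have g_nat: "g (real k) = c * k" for k
  proof -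
    have "(\<Sum>i<k. b i) = (\<Sum>i<k. b 0)" by (intro sum.cong refl b_const)
    then show ?thesis by (simp add: g_sum c_def)
  qed
  define h where "h x = g x - c * x" for x
  \<comment> \<open>As \<open>b\<close> is constant, \<open>vimage_ge\<close> is an equality on the
    whole unit interval, hence also on each of the two parts into which \<open>x\<close> cuts
    it.\<close>
  have piece: "measure lebesgue (B \<inter> {real n..x}) = measure lebesgue (tent -` B \<inter> {real n..x})"
    if x: "x \<in> {real n..real n + 1}" for n x
  proof -
    have "measure lebesgue (tent -` B \<inter> {real n..real n + 1}) = measure lebesgue (B \<inter> {real n..real n + 1})"
      using b_const[of n] unfolding vimage_unit g_nat by (simp add: b_def c_def)
    then show ?thesis
      using measure_Int_Icc_split[OF B, of "real n" x "real n + 1"]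
        measure_Int_Icc_split[OF B', of "real n" x "real n + 1"]
        vimage_ge[of "real n" x] vimage_ge[of x "real n + 1"] x by auto
  qed
  have h_bound: "\<bar>h x\<bar> \<le> 1" and h_step: "\<bar>h x\<bar> \<le> \<bar>h (tent x)\<bar> / 5" if "0 \<le> x" for x
  proof -
    define n where "n = nat \<lfloor>x\<rfloor>"
    have x: "x \<in> {real n..real n + 1}" unfolding n_def using that by (rule mem_unit_Icc)
    have hx: "h x = measure lebesgue (B \<inter> {real n..x}) - c * (x - real n)"
      using g_add[of "real n" x] x by (simp add: h_def g_nat algebra_simps)
    have "0 \<le> c * (x - real n)" "c * (x - real n) \<le> 1"
      using x c by (auto intro: mult_le_one)
    moreover have "measure lebesgue (B \<inter> {real n..x}) \<le> 1" using bound[of "real n" x] x by auto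
    ultimately show "\<bar>h x\<bar> \<le> 1" unfolding hx by (smt (verit) measure_nonneg)
    define N where "N = real (slope n)"
    have N: "5 \<le> N" using slope_ge_5[of n] by (simp add: N_def)
    have tx: "tent x = N * (if even n then x - real n else real n + 1 - x)"
      using tent_eq[OF x] by (simp add: N_def)
    have t0: "0 \<le> tent x" "tent x \<le> N"
      using x N by (auto simp: tx mult_le_cancel_left2)
    have "\<bar>h x\<bar> = \<bar>h (tent x)\<bar> / N"
    proof (cases "even n")
      case True
      then have "measure lebesgue (B \<inter> {real n..x}) = g (tent x) / N"
        unfolding piece[OF x] using measure_tent_vimage[of n "real n" x B] tent_eq[of "real n" n] x
        by (simp add: g_def N_def)
      then have "h x = h (tent x) / N"
        unfolding hx using True N by (simp add: h_def tx field_simps)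
      then show ?thesis using N by simp
    next
      case False
      \<comment> \<open>The decreasing branch sends the interval from \<open>n\<close> to
        \<open>x\<close> onto that from \<open>tent x\<close> to \<open>N\<close>. Since
        \<open>h\<close> vanishes at the integer \<open>N\<close>, only the sign differs from the
        increasing case.\<close>
      then have "measure lebesgue (B \<inter> {real n..x}) = measure lebesgue (B \<inter> {tent x..N}) / N"
        unfolding piece[OF x] using measure_tent_vimage[of n "real n" x B] tent_eq[of "real n" n] x
        by (simp add: N_def)
      also have "measure lebesgue (B \<inter> {tent x..N}) = c * N - g (tent x)"
        using g_add[of "tent x" N] t0 g_nat[of "slope n"] by (simp add: N_def)
      finally have "h x = - h (tent x) / N"
        unfolding hx using False N by (simp add: h_def tx field_simps)
      then show ?thesis using N by simp
    qed
    also have "\<dots> \<le> \<bar>h (tent x)\<bar> / 5" using N by (intro divide_left_mono) auto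
    finally show "\<bar>h x\<bar> \<le> \<bar>h (tent x)\<bar> / 5" .
  qed
  have h_pow: "\<bar>h x\<bar> \<le> (1 / 5) ^ k" if "0 \<le> x" for k x
    using that
  proof (induction k arbitrary: x)
    case (Suc k)
    then show ?case using h_step[of x] tent_nonneg[of x] by fastforce
  qed (use h_bound in simp)
  have "h x = 0" if "0 \<le> x" for x
  proof -
    have "(\<lambda>k. (1 / 5 :: real) ^ k) \<longlonglongrightarrow> 0" by (intro LIMSEQ_power_zero) simp
    then have "\<bar>h x\<bar> \<le> 0"
      using h_pow[OF that] by (intro LIMSEQ_le_const) auto
    then show ?thesis by simp
  qed
  then show ?thesis using that[of c] by (simp add: h_def g_def)
qed

text \<open>On the avoided interval the constant density of \<open>B\<close> must be 0, so
  \<open>B\<close> is null on every bounded interval.\<close>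

lemma tent_invariant_avoiding_negligible:
  assumes B: "B \<in> sets borel" and inv: "\<And>x. x \<in> B \<Longrightarrow> tent x \<in> B"
    and pos: "B \<subseteq> {0..}" and pq: "0 \<le> p" "p < q" and disj: "B \<inter> {p<..<q} = {}"
  shows "negligible B"
proof -
  obtain c where c: "\<And>x. 0 \<le> x \<Longrightarrow> measure lebesgue (B \<inter> {0..x}) = c * x"
    using tent_invariant_density[OF B inv] by blast
  have "B \<inter> {p..q} \<subseteq> {p, q}" using disj by force
  then have "negligible (B \<inter> {p..q})" by (meson finite.intros negligible_finite negligible_subset)
  then have "measure lebesgue (B \<inter> {p..q}) = 0" by (rule negligible_imp_measure0)
  then have "c * q = c * p"
    using measure_Int_Icc_split[OF B, of 0 p q] pq c[of p] c[of q] by simp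
  then have "c = 0" using pq by simp
  have "negligible (B \<inter> {0..real n})" for n
  proof -
    have "B \<inter> {0..real n} \<in> lmeasurable" using B by (rule lmeasurable_Int_Icc)
    then show ?thesis using c[of "real n"] \<open>c = 0\<close> by (simp add: negligible_iff_measure)
  qed
  then have "negligible (\<Union>(range (\<lambda>n. B \<inter> {0..real n})))" by (intro negligible_countable_Union) auto
  moreover have "B \<subseteq> (\<Union>n. B \<inter> {0..real n})" using pos real_arch_simple by fastforce
  ultimately show ?thesis using negligible_subset by blast
qed

section \<open>Density of almost every orbit\<close>

text \<open>The exceptional points form a forward invariant set, as the orbit of
  \<open>tent x\<close> is a tail of that of \<open>x\<close>; the case \<open>k = 0\<close> shows
  that this set avoids the interval.\<close>

lemma AE_tent_orbit_hits:
  assumes "0 \<le> p" "p < q"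
  shows "AE x in lebesgue. 0 \<le> x \<longrightarrow> (\<exists>k. (tent ^^ k) x \<in> {p<..<q})"
proof -
  define B where "B = {x. 0 \<le> x \<and> (\<forall>k. (tent ^^ k) x \<notin> {p<..<q})}"
  have [measurable]: "(tent ^^ k) \<in> borel_measurable borel" for k
    by (rule measurable_compose_n) measurable
  have B: "B \<in> sets borel" unfolding B_def by measurable
  have inv: "tent x \<in> B" if "x \<in> B" for x
  proof -
    have "(tent ^^ k) (tent x) \<notin> {p<..<q}" for k
      using that unfolding B_def by (metis (mono_tags, lifting) funpow_Suc_right comp_apply mem_Collect_eq)
    then show ?thesis using that tent_nonneg by (auto simp: B_def)
  qed
  have "(tent ^^ 0) x \<notin> {p<..<q}" if "x \<in> B" for x
    using that unfolding B_def by blast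
  then have "negligible B"
    using assms by (intro tent_invariant_avoiding_negligible[OF B inv, of p q]) (auto simp: B_def)
  then have "B \<in> null_sets lebesgue" by (simp add: negligible_iff_null_sets)
  moreover have "{x \<in> space lebesgue. \<not> (0 \<le> x \<longrightarrow> (\<exists>k. (tent ^^ k) x \<in> {p<..<q}))} \<subseteq> B"
    by (auto simp: B_def)
  ultimately show ?thesis by (rule AE_I')
qed

text \<open>Intervals with rational endpoints suffice for density, and being countably many they
  share one exceptional null set.\<close>

lemma AE_tent_orbit_dense:
  "AE x in lebesgue. 0 \<le> x \<longrightarrow> closure (range (\<lambda>k. (tent ^^ k) x)) = {0..}"
proof -
  have "AE x in lebesgue. \<forall>p\<in>\<rat>. \<forall>q\<in>\<rat>. 0 \<le> p \<and> p < q \<longrightarrow> 0 \<le> x \<longrightarrow> (\<exists>k. (tent ^^ k) x \<in> {p<..<q})"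
    using AE_tent_orbit_hits by (intro AE_ball_countable' countable_rat) auto
  then show ?thesis
  proof (rule AE_mp, intro AE_I2 impI)
    fix x :: real
    assume hits: "\<forall>p\<in>\<rat>. \<forall>q\<in>\<rat>. 0 \<le> p \<and> p < q \<longrightarrow> 0 \<le> x \<longrightarrow> (\<exists>k. (tent ^^ k) x \<in> {p<..<q})"
      and x: "0 \<le> x"
    have nonneg: "0 \<le> (tent ^^ k) x" for k by (induction k) (use x tent_nonneg in auto)
    show "closure (range (\<lambda>k. (tent ^^ k) x)) = {0..}"
    proof (intro equalityI closure_minimal subsetI)
      fix y :: real assume y: "y \<in> {0..}"
      show "y \<in> closure (range (\<lambda>k. (tent ^^ k) x))"
        unfolding closure_approachable
      proof (intro allI impI)
        fix e :: real assume e: "0 < e"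
        \<comment> \<open>Both endpoints lie to the right of \<open>y\<close>, which keeps the
          interval in the half-line even for \<open>y = 0\<close>.\<close>
        obtain p where p: "p \<in> \<rat>" "y < p" "p < y + e" using Rats_dense_in_real[of y "y + e"] e by auto
        obtain q where q: "q \<in> \<rat>" "p < q" "q < y + e" using Rats_dense_in_real[of p "y + e"] p by auto
        obtain k where "(tent ^^ k) x \<in> {p<..<q}" using hits p q x y by fastforce
        then show "\<exists>z\<in>range (\<lambda>k. (tent ^^ k) x). dist z y < e"
          using p q by (intro bexI[of _ "(tent ^^ k) x"]) (auto simp: dist_real_def)
      qed
    qed (use nonneg in auto)
  qed
qed

section \<open>Lower and upper limits of dense sequences\<close>

lemma dense_orbit_liminf_limsup:
  fixes a :: "nat \<Rightarrow> real"
  assumes dense: "closure (range a) = {0..}"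
  shows "liminf (\<lambda>k. ereal (a k)) = 0" "limsup (\<lambda>k. ereal (a k)) = \<infinity>"
proof -
  have nonneg: "0 \<le> a k" for k using closure_subset[of "range a"] dense by auto
  have freq: "\<exists>k\<ge>K. a k \<in> {p<..<q}" if "0 \<le> p" "p < q" for K p q
  proof -
    \<comment> \<open>Deleting the first \<open>K\<close> terms leaves a nonempty open set, so
      density yields an index that is at least \<open>K\<close>.\<close>
    have "infinite ({p<..<q} - a ` {..<K})" using that by (simp add: infinite_Ioo)
    have "open ({p<..<q} - a ` {..<K})" by (intro open_Diff finite_imp_closed) auto
    moreover obtain z where "z \<in> {p<..<q} - a ` {..<K}"
      using \<open>infinite _\<close> by (metis finite.emptyI ex_in_conv)
    ultimately obtain e where e: "0 < e" "ball z e \<subseteq> {p<..<q} - a ` {..<K}"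
      unfolding open_contains_ball by blast
    have "z \<in> closure (range a)" using \<open>z \<in> _\<close> that by (simp add: dense)
    then obtain k where "dist (a k) z < e" using e unfolding closure_approachable by blast
    then have "a k \<in> {p<..<q} - a ` {..<K}" using e by (auto simp: dist_commute)
    then show ?thesis by (intro exI[of _ k]) (auto simp: not_less[symmetric])
  qed
  show "liminf (\<lambda>k. ereal (a k)) = 0"
  proof (rule antisym)
    show "liminf (\<lambda>k. ereal (a k)) \<le> 0"
    proof (rule ccontr)
      assume "\<not> liminf (\<lambda>k. ereal (a k)) \<le> 0"
      then obtain e where e: "0 < ereal e" "ereal e < liminf (\<lambda>k. ereal (a k))"
        using ereal_dense2[of 0] by (auto simp: not_le)
      then have "eventually (\<lambda>k. ereal e < ereal (a k)) sequentially" by (intro less_LiminfD)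
      then obtain K where "\<And>k. k \<ge> K \<Longrightarrow> e < a k" by (auto simp: eventually_sequentially)
      then show False using freq[of 0 e K] e by fastforce
    qed
  qed (use nonneg in \<open>simp add: Liminf_bounded\<close>)
  show "limsup (\<lambda>k. ereal (a k)) = \<infinity>"
  proof (rule ccontr)
    assume "limsup (\<lambda>k. ereal (a k)) \<noteq> \<infinity>"
    then obtain C where C: "limsup (\<lambda>k. ereal (a k)) < ereal C"
      using ereal_dense2[of _ \<infinity>] by (metis ereal_infty_less(1))
    then have "eventually (\<lambda>k. ereal (a k) < ereal C) sequentially" by (intro Limsup_lessD)
    then obtain K where "\<And>k. k \<ge> K \<Longrightarrow> a k < C" by (auto simp: eventually_sequentially)
    then show False using freq[of "max 0 C" "max 0 C + 1" K] by fastforce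
  qed
qed

section \<open>Transfer from the explicit map to \<open>T\<close>\<close>

theorem corollary6p10:
  fixes T :: "real \<Rightarrow> real"
  assumes maps: "T \<in> {0..} \<rightarrow> {0..}"
    and affine: "\<And>n::nat. \<exists>a b. \<forall>x\<in>{real n..real n + 1}. T x = a * x + b"
    and at_even: "\<And>n::nat. even n \<Longrightarrow> T (real n) = 0"
    and at_odd: "\<And>n l::nat. odd n \<Longrightarrow> 1 \<le> l \<Longrightarrow> 4 ^ (l - 1) \<le> n \<Longrightarrow> n < 4 ^ l
      \<Longrightarrow> T (real n) = 4 ^ l + 1"
  shows "(AE x in lebesgue_on {0..}. closure (range (\<lambda>k. (T ^^ k) x)) = {0..}) \<and>
    (AE x in lebesgue_on {0..}.
      liminf (\<lambda>k. ereal ((T ^^ k) x)) = 0 \<and> limsup (\<lambda>k. ereal ((T ^^ k) x)) = \<infinity>)"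
proof -
  have T_odd: "T (real n) = slope n" if "odd n" for n
    using at_odd[OF that lev_ge_1 pow_lev_le[OF that] less_pow_lev] by (simp add: slope_def)
  have T_eq: "T x = tent x" if "0 \<le> x" for x
  proof -
    define n where "n = nat \<lfloor>x\<rfloor>"
    have x: "x \<in> {real n..real n + 1}" unfolding n_def using that by (rule mem_unit_Icc)
    obtain a b where ab: "\<And>x. x \<in> {real n..real n + 1} \<Longrightarrow> T x = a * x + b"
      using affine[of n] by blast
    have ends: "T (real n) = a * n + b" "T (real (Suc n)) = a * (real n + 1) + b"
      using ab[of "real n"] ab[of "real n + 1"] by (auto simp: add.commute)
    \<comment> \<open>Linear interpolation between the two integer endpoints, where the values of
      \<open>T\<close> are prescribed.\<close>
    have T_x: "T x = T (real n) + (T (real (Suc n)) - T (real n)) * (x - real n)"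
      unfolding ends ab[OF x] by (simp add: algebra_simps)
    show ?thesis
    proof (cases "even n")
      case True
      then have "slope (Suc n) = slope n" by (simp add: slope_def lev_Suc_even)
      then show ?thesis using True tent_eq[OF x] T_odd[of "Suc n"] at_even[of n] T_x by simp
    next
      case False
      then show ?thesis
        using tent_eq[OF x] T_odd[of n] at_even[of "Suc n"] T_x by (simp add: algebra_simps)
    qed
  qed
  \<comment> \<open>Nonnegativity is carried through the induction because \<open>T_eq\<close>
    applies only on the half-line.\<close>
  have orbit: "(T ^^ k) x = (tent ^^ k) x \<and> 0 \<le> (T ^^ k) x" if "0 \<le> x" for k x
    by (induction k) (use that T_eq tent_nonneg in auto)
  have "AE x in lebesgue_on {0..}. closure (range (\<lambda>k. (T ^^ k) x)) = {0..}"
    using AE_tent_orbit_dense by (subst AE_restrict_space_iff) (auto simp: orbit cong: AE_cong_simp)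
  moreover from this have "AE x in lebesgue_on {0..}.
      liminf (\<lambda>k. ereal ((T ^^ k) x)) = 0 \<and> limsup (\<lambda>k. ereal ((T ^^ k) x)) = \<infinity>"
    by (rule AE_mp) (intro AE_I2 impI conjI dense_orbit_liminf_limsup)
  ultimately show ?thesis ..
qed

end
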